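(* Let $\mathcal{L}$ be a subspace lattice on a Banach space $X$ over $\mathbb{K}\in\{\mathbb{R},\mathbb{C}\}$ such that $\vee\{F:F\in\mathcal{J}(\mathcal{L})\}=X$ or $\wedge\{L_-:L\in\mathcal{J}(\mathcal{L})\}=(0)$. If $\delta:\mathrm{alg}\mathcal{L}\to B(X)$ is a linear map satisfying $(m+n+l)\delta(A^2)=m\delta(A)A+nA\delta(A)+lA\delta(I)A$ for all $A\in\mathrm{alg}\mathcal{L}$, then $\delta(AB)=\delta(A)B=A\delta(B)$ for all $A,B\in\mathrm{alg}\mathcal{L}$.
   Context: Fixed integers $m,n,l\ge 0$ satisfy $m+l\ge1$ and $n+l\ge1$. A subspace lattice $\mathcal{L}$ on $X$ is a collection of closed subspaces containing $(0)$ and $X$ and closed under arbitrary intersections and closed linear spans; $\mathrm{alg}\mathcal{L}$ is the algebra of bounded operators leaving every member of $\mathcal{L}$ invariant. For $E\in\mathcal{L}$, $E_-=\vee\{F\in\mathcal{L}:F\not\supseteq E\}$; $\mathcal{J}(\mathcal{L})=\{K\in\mathcal{L}:K\ne(0),\ K_-\ne X\}$. *)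

theory Defs
  imports "HOL-Analysis.Analysis"
begin

text \<open>Scalar field K (real or complex) acting on a real Banach space 'a.
  A K-Banach space is a real Banach space with a compatible K-action sm.\<close>

definition kaction :: "('k::real_normed_field \<Rightarrow> 'a::real_normed_vector \<Rightarrow> 'a) \<Rightarrow> bool" where
  "kaction sm \<longleftrightarrow>
     (\<forall>a b x. sm (a + b) x = sm a x + sm b x) \<and>
     (\<forall>a x y. sm a (x + y) = sm a x + sm a y) \<and>
     (\<forall>a b x. sm (a * b) x = sm a (sm b x)) \<and>
     (\<forall>r x. sm (of_real r) x = r *\<^sub>R x) \<and>
     (\<forall>a x. norm (sm a x) = norm a * norm x)"

definition ksubspace :: "('k \<Rightarrow> 'a::real_normed_vector \<Rightarrow> 'a) \<Rightarrow> 'a set \<Rightarrow> bool" where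
  "ksubspace sm V \<longleftrightarrow> 0 \<in> V \<and> (\<forall>x\<in>V. \<forall>y\<in>V. x + y \<in> V) \<and> (\<forall>c. \<forall>x\<in>V. sm c x \<in> V)"

definition closed_ksubspace :: "('k \<Rightarrow> 'a::real_normed_vector \<Rightarrow> 'a) \<Rightarrow> 'a set \<Rightarrow> bool" where
  "closed_ksubspace sm V \<longleftrightarrow> ksubspace sm V \<and> closed V"

definition kjoin :: "('k \<Rightarrow> 'a::real_normed_vector \<Rightarrow> 'a) \<Rightarrow> 'a set set \<Rightarrow> 'a set" where
  "kjoin sm \<F> = \<Inter>{V. closed_ksubspace sm V \<and> \<Union>\<F> \<subseteq> V}"

definition subspace_lattice :: "('k \<Rightarrow> 'a::real_normed_vector \<Rightarrow> 'a) \<Rightarrow> 'a set set \<Rightarrow> bool" where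
  "subspace_lattice sm \<L> \<longleftrightarrow>
     (\<forall>E\<in>\<L>. closed_ksubspace sm E) \<and> {0} \<in> \<L> \<and> UNIV \<in> \<L> \<and>
     (\<forall>\<F>. \<F> \<subseteq> \<L> \<longrightarrow> \<Inter>\<F> \<in> \<L> \<and> kjoin sm \<F> \<in> \<L>)"

definition Bops :: "('k \<Rightarrow> 'a::real_normed_vector \<Rightarrow> 'a) \<Rightarrow> ('a \<Rightarrow> 'a) set" where
  "Bops sm = {T. bounded_linear T \<and> (\<forall>c x. T (sm c x) = sm c (T x))}"

definition alg :: "('k \<Rightarrow> 'a::real_normed_vector \<Rightarrow> 'a) \<Rightarrow> 'a set set \<Rightarrow> ('a \<Rightarrow> 'a) set" where
  "alg sm \<L> = {T \<in> Bops sm. \<forall>E\<in>\<L>. T ` E \<subseteq> E}"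

definition lminus :: "('k \<Rightarrow> 'a::real_normed_vector \<Rightarrow> 'a) \<Rightarrow> 'a set set \<Rightarrow> 'a set \<Rightarrow> 'a set" where
  "lminus sm \<L> E = kjoin sm {F \<in> \<L>. \<not> E \<subseteq> F}"

definition Jset :: "('k \<Rightarrow> 'a::real_normed_vector \<Rightarrow> 'a) \<Rightarrow> 'a set set \<Rightarrow> 'a set set" where
  "Jset sm \<L> = {K \<in> \<L>. K \<noteq> {0} \<and> lminus sm \<L> K \<noteq> UNIV}"

definition thm214_claim :: "('k::real_normed_field \<Rightarrow> 'a::banach \<Rightarrow> 'a) \<Rightarrow> nat \<Rightarrow> nat \<Rightarrow> nat \<Rightarrow> bool" where
  "thm214_claim sm m n l \<longleftrightarrow>
    (\<forall>\<L> \<delta>.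
      subspace_lattice sm \<L> \<longrightarrow>
      (kjoin sm (Jset sm \<L>) = UNIV \<or> \<Inter>(lminus sm \<L> ` Jset sm \<L>) = {0}) \<longrightarrow>
      (\<forall>A\<in>alg sm \<L>. \<delta> A \<in> Bops sm) \<longrightarrow>
      (\<forall>A\<in>alg sm \<L>. \<forall>B\<in>alg sm \<L>. \<delta> (\<lambda>x. A x + B x) = (\<lambda>x. \<delta> A x + \<delta> B x)) \<longrightarrow>
      (\<forall>c. \<forall>A\<in>alg sm \<L>. \<delta> (\<lambda>x. sm c (A x)) = (\<lambda>x. sm c (\<delta> A x))) \<longrightarrow>
      (\<forall>A\<in>alg sm \<L>.
         (\<lambda>x. real (m + n + l) *\<^sub>R \<delta> (A \<circ> A) x) =
         (\<lambda>x. real m *\<^sub>R \<delta> A (A x) + real n *\<^sub>R A (\<delta> A x) + real l *\<^sub>R A (\<delta> id (A x)))) \<longrightarrow>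
      (\<forall>A\<in>alg sm \<L>. \<forall>B\<in>alg sm \<L>. \<delta> (A \<circ> B) = \<delta> A \<circ> B \<and> \<delta> (A \<circ> B) = A \<circ> \<delta> B))"

end

theory Submission
  imports Defs
begin

text \<open>Put \<open>T = \<delta>(I)\<close>. Polarizing the identity shows that \<open>\<delta>(A)\<close> is a convex combination of \<open>TA\<close>
  and \<open>AT\<close> with positive weights and that \<open>[A, [A, T]] = 0\<close>, so it suffices that \<open>T\<close> commutes with
  the algebra. The derivation \<open>D(A) = TA - AT\<close> satisfies \<open>[A, D(A)] = 0\<close>, and Posner's argument gives
  \<open>[A, B] C D(A) = 0 = D(A) C [A, B]\<close>. For \<open>K\<close> in the lattice, \<open>x \<in> K\<close> and \<open>f\<close> annihilating \<open>K_-\<close>, the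
  rank-one operator \<open>x \<otimes> f\<close> lies in the algebra; taking it for \<open>C\<close>, either \<open>D(A) x = 0\<close> or
  \<open>f \<circ> [A, B] = 0\<close>. If some rank-one operator attached to \<open>K\<close> is idempotent, then
  \<open>T\<close> is a scalar on \<open>K\<close>; otherwise the join (or meet) condition provides further rank-one
  operators that exclude the second alternative.\<close>

subsection \<open>Hahn-Banach separation\<close>

definition sublinear :: "('a::real_vector \<Rightarrow> real) \<Rightarrow> bool" where
  "sublinear q \<longleftrightarrow> (\<forall>x y. q (x + y) \<le> q x + q y) \<and> (\<forall>c x. 0 \<le> c \<longrightarrow> q (c *\<^sub>R x) \<le> c * q x)"

lemma sublinear_add: "sublinear q \<Longrightarrow> q (x + y) \<le> q x + q y"
  by (simp add: sublinear_def)

lemma sublinear_zero: assumes "sublinear q" shows "q 0 = 0"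
proof -
  have "q (0 *\<^sub>R 0) \<le> 0 * q 0" using assms unfolding sublinear_def by blast
  moreover have "q (0 + 0) \<le> q 0 + q 0" using assms by (rule sublinear_add)
  ultimately show ?thesis by simp
qed

lemma sublinear_scale: assumes "sublinear q" "0 \<le> c" shows "q (c *\<^sub>R x) = c * q x"
proof (cases "c = 0")
  case True then show ?thesis using sublinear_zero[OF assms(1)] by simp
next
  case False
  have le: "q (c *\<^sub>R x) \<le> c * q x" if "0 \<le> c" for c x
    using assms(1) that by (simp add: sublinear_def)
  have "q (inverse c *\<^sub>R (c *\<^sub>R x)) \<le> inverse c * q (c *\<^sub>R x)"
    using assms(2) by (intro le) simp
  then have "c * q x \<le> q (c *\<^sub>R x)"
    using False assms(2) by (simp add: field_simps)
  with le[OF assms(2)] show ?thesis by (simp add: order_antisym)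
qed

lemma sublinear_lower: assumes "sublinear q" shows "- q (- x) \<le> q x"
  using sublinear_add[OF assms, of x "- x"] sublinear_zero[OF assms] by simp

text \<open>The witness is the infimum over \<open>t \<ge> 0\<close> of
  \<open>q (z + t y) - t q y\<close>: \<open>t = 0\<close> gives \<open>r \<le> q\<close>, and
  \<open>t = 1\<close> gives the bound involving \<open>y\<close>. It serves both to show that
  minimal functionals are additive and to separate a point from a subspace.\<close>

lemma sublinear_shear:
  assumes q: "sublinear q"
  obtains r where "sublinear r" "r \<le> q" "\<And>z. r z \<le> q (z + y) - q y"
proof
  define g where "g z t = q (z + t *\<^sub>R y) - t * q y" for z t
  define r where "r z = (INF t\<in>{0..}. g z t)" for z
  \<comment> \<open>This bound does not depend on \<open>t\<close>, so the infimum is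
    finite.\<close>
  have lower: "- q (- z) \<le> g z t" if "0 \<le> t" for z t
  proof -
    have "q ((z + t *\<^sub>R y) + - z) \<le> q (z + t *\<^sub>R y) + q (- z)" by (rule sublinear_add[OF q])
    then show ?thesis using sublinear_scale[OF q that, of y] by (simp add: g_def)
  qed
  have bdd: "bdd_below (g z ` {0..})" for z
    using lower by (intro bdd_belowI[of _ "- q (- z)"]) auto
  have r_le: "r z \<le> g z t" if "0 \<le> t" for z t
    unfolding r_def using that bdd by (intro cINF_lower) auto
  have le_r: "a \<le> r z" if "\<And>t. 0 \<le> t \<Longrightarrow> a \<le> g z t" for a z
    unfolding r_def using that by (intro cINF_greatest) auto
  show "r \<le> q"
    using r_le[of 0] by (auto simp: le_fun_def g_def)
  show "r z \<le> q (z + y) - q y" for z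
    using r_le[of 1 z] by (simp add: g_def)
  show "sublinear r" unfolding sublinear_def
  proof safe
    fix z w
    \<comment> \<open>The two infima are taken one after the other; parameters \<open>s\<close> for
      \<open>z\<close> and \<open>t\<close> for \<open>w\<close> add up to an admissible parameter
      for \<open>z + w\<close>.\<close>
    have "r (z + w) - g w t \<le> r z" if "0 \<le> t" for t
    proof (rule le_r)
      fix s :: real assume "0 \<le> s"
      have "q ((z + s *\<^sub>R y) + (w + t *\<^sub>R y)) \<le> q (z + s *\<^sub>R y) + q (w + t *\<^sub>R y)"
        by (rule sublinear_add[OF q])
      moreover have "(z + s *\<^sub>R y) + (w + t *\<^sub>R y) = z + w + (s + t) *\<^sub>R y"
        by (simp add: algebra_simps)
      ultimately have "g (z + w) (s + t) \<le> g z s + g w t"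
        by (simp add: g_def algebra_simps)
      then show "r (z + w) - g w t \<le> g z s"
        using r_le[of "s + t" "z + w"] \<open>0 \<le> s\<close> that by simp
    qed
    then have "r (z + w) - r z \<le> r w" by (intro le_r) (simp add: algebra_simps)
    then show "r (z + w) \<le> r z + r w" by simp
  next
    fix c :: real and z assume c: "0 \<le> c"
    show "r (c *\<^sub>R z) \<le> c * r z"
    proof (cases "c = 0")
      case True
      then show ?thesis using r_le[of 0 0] sublinear_zero[OF q] by (simp add: g_def)
    next
      case False
      with c have c0: "c > 0" by simp
      have "r (c *\<^sub>R z) / c \<le> r z"
      proof (rule le_r)
        fix t :: real assume t: "0 \<le> t"
        have "g (c *\<^sub>R z) (c * t) = c * g z t"
          using sublinear_scale[OF q c, of "z + t *\<^sub>R y"]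
          by (simp add: g_def algebra_simps)
        then have "r (c *\<^sub>R z) \<le> c * g z t"
          using r_le[of "c * t" "c *\<^sub>R z"] c t by simp
        then show "r (c *\<^sub>R z) / c \<le> g z t" using c0 by (simp add: field_simps)
      qed
      then show ?thesis using c0 by (simp add: field_simps)
    qed
  qed
qed

text \<open>The common majorant \<open>p\<close> yields the uniform lower bound
  \<open>- p (- x)\<close>, and comparability of any two members keeps the pointwise infimum
  subadditive.\<close>

lemma sublinear_chain_INF:
  assumes ne: "C \<noteq> {}" and sub: "\<And>q. q \<in> C \<Longrightarrow> sublinear q \<and> q \<le> p"
    and chain: "\<And>q r. q \<in> C \<Longrightarrow> r \<in> C \<Longrightarrow> q \<le> r \<or> r \<le> q"
  obtains u where "sublinear u" "\<And>q. q \<in> C \<Longrightarrow> u \<le> q"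
proof
  define u where "u x = (INF q\<in>C. q x)" for x
  have "- p (- x) \<le> q x" if "q \<in> C" for q x
    using sublinear_lower[of q x] le_funD[of q p "- x"] sub[OF that] by auto
  then have bdd: "bdd_below ((\<lambda>q. q x) ` C)" for x
    by (intro bdd_belowI[of _ "- p (- x)"]) auto
  have u_le: "u x \<le> q x" if "q \<in> C" for q x
    unfolding u_def using that bdd by (intro cINF_lower) auto
  have le_u: "a \<le> u x" if "\<And>q. q \<in> C \<Longrightarrow> a \<le> q x" for a x
    unfolding u_def using that ne by (intro cINF_greatest) auto
  show "u \<le> q" if "q \<in> C" for q using u_le[OF that] by (simp add: le_fun_def)
  show "sublinear u" unfolding sublinear_def
  proof safe
    fix x y
    have "u (x + y) - q y \<le> u x" if "q \<in> C" for q
    proof (rule le_u)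
      fix r assume "r \<in> C"
      then obtain s where s: "s \<in> C" "s \<le> q" "s \<le> r" using chain \<open>q \<in> C\<close> by blast
      have "u (x + y) \<le> s x + s y"
        using u_le[OF s(1), of "x + y"] sublinear_add[of s x y] sub[OF s(1)] by linarith
      also have "\<dots> \<le> r x + q y" using s by (simp add: le_fun_def add_mono)
      finally show "u (x + y) - q y \<le> r x" by simp
    qed
    then have "u (x + y) - u x \<le> u y" by (intro le_u) (simp add: algebra_simps)
    then show "u (x + y) \<le> u x + u y" by simp
  next
    fix c :: real and x assume c: "0 \<le> c"
    show "u (c *\<^sub>R x) \<le> c * u x"
    proof (cases "c = 0")
      case True
      obtain q where "q \<in> C" using ne by blast
      with True u_le[of q 0] sublinear_zero[of q] sub show ?thesis by simp
    next
      case False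
      have "u (c *\<^sub>R x) / c \<le> u x"
      proof (rule le_u)
        fix q assume "q \<in> C"
        then show "u (c *\<^sub>R x) / c \<le> q x"
          using u_le[of q "c *\<^sub>R x"] sublinear_scale[of q c x] sub False c
          by (simp add: field_simps)
      qed
      then show ?thesis using c False by (simp add: field_simps)
    qed
  qed
qed

text \<open>A minimal sublinear functional below \<open>p\<close> is linear, because shearing cannot decrease it.\<close>

lemma sublinear_dominates_linear:
  fixes p :: "'a::real_vector \<Rightarrow> real"
  assumes p: "sublinear p"
  obtains u where "linear u" "u \<le> p"
proof -
  let ?A = "{q. sublinear q \<and> q \<le> p}"
  have "\<exists>m\<in>?A. \<forall>a\<in>?A. a \<le> m \<longrightarrow> a = m"
  \<comment> \<open>The order is reversed, so that a maximal element is a minimal sublinear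
    functional and chains need lower bounds.\<close>
  proof (rule predicate_Zorn[where P = "\<lambda>q r. r \<le> q"])
    show "partial_order_on ?A (relation_of (\<lambda>q r. r \<le> q) ?A)"
      by (rule partial_order_on_relation_ofI) auto
  next
    fix C assume C: "C \<in> Chains (relation_of (\<lambda>q r. r \<le> q) ?A)"
    show "\<exists>u\<in>?A. \<forall>a\<in>C. u \<le> a"
    proof (cases "C = {}")
      case True then show ?thesis using p by auto
    next
      case False
      have sub: "sublinear q \<and> q \<le> p" if "q \<in> C" for q
        using Chains_relation_of[OF C] that by auto
      moreover have "q \<le> r \<or> r \<le> q" if "q \<in> C" "r \<in> C" for q r
        using C that by (auto simp: Chains_def relation_of_def)
      ultimately obtain u where u: "sublinear u" "\<And>q. q \<in> C \<Longrightarrow> u \<le> q"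
        using sublinear_chain_INF[of C p] False by blast
      moreover have "u \<le> p" using False u(2) sub by (meson all_not_in_conv order_trans)
      ultimately show ?thesis by auto
    qed
  qed
  then obtain m where m: "sublinear m" "m \<le> p"
    and min: "\<And>a. sublinear a \<Longrightarrow> a \<le> p \<Longrightarrow> a \<le> m \<Longrightarrow> a = m" by auto
  have add: "m (z + y) = m z + m y" for z y
  proof -
    obtain r where r: "sublinear r" "r \<le> m" "\<And>z. r z \<le> m (z + y) - m y"
      using sublinear_shear[OF m(1)] by blast
    have "r = m" using min[OF r(1) _ r(2)] r(2) m(2) by (auto intro: order_trans)
    then show ?thesis using r(3)[of z] sublinear_add[OF m(1), of z y] by simp
  qed
  have neg: "m (- z) = - m z" for z
    using add[of z "- z"] sublinear_zero[OF m(1)] by simp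
  have "m (c *\<^sub>R z) = c * m z" for c z
  proof (cases "0 \<le> c")
    case True then show ?thesis by (rule sublinear_scale[OF m(1)])
  next
    case False
    then show ?thesis using sublinear_scale[OF m(1), of "- c" z] neg[of "c *\<^sub>R z"] by simp
  qed
  with add have "linear m" by (intro linearI) auto
  with m(2) show ?thesis using that by blast
qed

text \<open>Approximants in \<open>V\<close> of two points add up to an approximant of their sum,
  and they scale along with a point.\<close>

lemma sublinear_infdist:
  fixes V :: "'a::real_normed_vector set"
  assumes V: "subspace V"
  shows "sublinear (\<lambda>z. infdist z V)"
proof -
  have ne: "V \<noteq> {}" using subspace_0[OF V] by blast
  have le_inf: "a \<le> infdist z V" if "\<And>v. v \<in> V \<Longrightarrow> a \<le> dist z v" for a z
    using that ne by (simp add: infdist_def) (rule cINF_greatest)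
  show ?thesis unfolding sublinear_def
  proof safe
    fix x y
    have "infdist (x + y) V - dist y w \<le> infdist x V" if w: "w \<in> V" for w
    proof (rule le_inf)
      fix v assume "v \<in> V"
      then have "infdist (x + y) V \<le> dist (x + y) (v + w)"
        using w V by (intro infdist_le) (simp add: subspace_add)
      also have "\<dots> \<le> dist x v + dist y w" by (rule dist_triangle_add)
      finally show "infdist (x + y) V - dist y w \<le> dist x v" by simp
    qed
    then have "infdist (x + y) V - infdist x V \<le> infdist y V"
      by (intro le_inf) (simp add: algebra_simps)
    then show "infdist (x + y) V \<le> infdist x V + infdist y V" by simp
  next
    fix c :: real and x assume c: "0 \<le> c"
    show "infdist (c *\<^sub>R x) V \<le> c * infdist x V"
    proof (cases "c = 0")
      case True then show ?thesis using subspace_0[OF V] by simp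
    next
      case False
      have "infdist (c *\<^sub>R x) V / c \<le> infdist x V"
      proof (rule le_inf)
        fix v assume "v \<in> V"
        then have "infdist (c *\<^sub>R x) V \<le> dist (c *\<^sub>R x) (c *\<^sub>R v)"
          using V by (intro infdist_le) (simp add: subspace_scale)
        also have "\<dots> = c * dist x v"
          using c by (simp add: dist_norm flip: scaleR_diff_right)
        finally show "infdist (c *\<^sub>R x) V / c \<le> dist x v" using c False by (simp add: field_simps)
      qed
      then show ?thesis using c False by (simp add: field_simps)
    qed
  qed
qed

text \<open>Shear the distance to \<open>V\<close> along \<open>x\<close>. Since
  \<open>0 \<in> V\<close>, this gives \<open>r (- x) \<le> - infdist x V\<close>, which is negative
  because \<open>V\<close> is closed. A linear \<open>u \<le> r\<close> is therefore nonzero at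
  \<open>x\<close>, while being dominated by the distance makes it bounded and zero on
  \<open>V\<close>.\<close>

theorem Hahn_Banach_separation:
  fixes V :: "'a::real_normed_vector set"
  assumes V: "subspace V" "closed V" and x: "x \<notin> V"
  obtains u :: "'a \<Rightarrow> real" where "bounded_linear u" "\<And>v. v \<in> V \<Longrightarrow> u v = 0" "u x \<noteq> 0"
proof -
  have sub: "sublinear (\<lambda>z. infdist z V)" by (rule sublinear_infdist[OF V(1)])
  obtain r where r: "sublinear r" "r \<le> (\<lambda>z. infdist z V)"
      "\<And>z. r z \<le> infdist (z + x) V - infdist x V"
    using sublinear_shear[OF sub] by blast
  obtain u where u: "linear u" "u \<le> r" using sublinear_dominates_linear[OF r(1)] by blast
  have V0: "0 \<in> V" by (rule subspace_0[OF V(1)])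
  have le: "u z \<le> infdist z V" for z
    using u(2) r(2) by (auto simp: le_fun_def intro: order_trans)
  have up: "u z \<le> norm z" for z
    using le[of z] infdist_le[OF V0, of z] by simp
  have abs: "\<bar>u z\<bar> \<le> norm z" for z
    using up[of z] up[of "- z"] linear_neg[OF u(1), of z] by (simp add: abs_le_iff)
  show ?thesis
  proof (rule that)
    show "bounded_linear u"
      using u(1) abs by (intro bounded_linear_intro[where K = 1]) (auto simp: linear_add linear_scale)
    show "u v = 0" if v: "v \<in> V" for v
      using le[of v] le[of "- v"] linear_neg[OF u(1), of v] v V(1) by (simp add: subspace_neg)
    have "infdist x V \<noteq> 0"
      using x V V0 in_closed_iff_infdist_zero[of V x] by auto
    moreover have "u (- x) \<le> - infdist x V"
      using u(2) r(3)[of "- x"] V0 by (auto simp: le_fun_def intro: order_trans)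
    ultimately show "u x \<noteq> 0"
      using linear_neg[OF u(1), of x] infdist_nonneg[of x V] by simp
  qed
qed

subsection \<open>Rank-one operators\<close>

definition annihilator :: "('k::real_normed_field \<Rightarrow> 'a::real_normed_vector \<Rightarrow> 'a) \<Rightarrow> 'a set \<Rightarrow> ('a \<Rightarrow> 'k) set" where
  "annihilator sm V =
     {f. bounded_linear f \<and> (\<forall>c z. f (sm c z) = c * f z) \<and> (\<forall>v\<in>V. f v = 0)}"

definition tensor :: "('k \<Rightarrow> 'a \<Rightarrow> 'a) \<Rightarrow> 'a \<Rightarrow> ('a \<Rightarrow> 'k) \<Rightarrow> 'a \<Rightarrow> 'a" where
  "tensor sm x f = (\<lambda>z. sm (f z) x)"

text \<open>Separation by \<open>K\<close>-linear functionals is an assumption here so that one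
  argument covers both scalar fields; it is established for the real and the complex case
  separately.\<close>

locale kspace =
  fixes sm :: "'k::real_normed_field \<Rightarrow> 'a::real_normed_vector \<Rightarrow> 'a"
  assumes kaction: "kaction sm"
    and separation: "\<lbrakk>closed_ksubspace sm V; x \<notin> V\<rbrakk> \<Longrightarrow> \<exists>f\<in>annihilator sm V. f x = 1"
begin

lemma sm_add: "sm (a + b) x = sm a x + sm b x" "sm a (x + y) = sm a x + sm a y"
  and sm_mult: "sm (a * b) x = sm a (sm b x)"
  and sm_of_real: "sm (of_real r) x = r *\<^sub>R x"
  and norm_sm: "norm (sm a x) = norm a * norm x"
  using kaction by (simp_all add: kaction_def)

lemma sm_one [simp]: "sm 1 x = x"
  using sm_of_real[of 1 x] by simp

lemma sm_zero [simp]: "sm 0 x = 0" "sm a 0 = 0"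
  using norm_sm[of 0 x] norm_sm[of a 0] by simp_all

lemma sm_eq_0_iff [simp]: "sm a x = 0 \<longleftrightarrow> a = 0 \<or> x = 0"
  by (metis norm_sm norm_eq_zero mult_eq_0_iff)

lemma sm_diff: "sm (a - b) x = sm a x - sm b x" "sm a (x - y) = sm a x - sm a y"
  using sm_add(1)[of "a - b" b x] sm_add(2)[of a "x - y" y] by (simp_all add: algebra_simps)

lemma sm_left_cancel: "sm a x = sm b x \<longleftrightarrow> a = b \<or> x = 0"
  using sm_eq_0_iff[of "a - b" x] by (simp add: sm_diff)

lemma Bops_linear:
  assumes "A \<in> Bops sm"
  shows "A (x + y) = A x + A y" "A (x - y) = A x - A y" "A (r *\<^sub>R x) = r *\<^sub>R A x"
    "A 0 = 0" "A (sm c x) = sm c (A x)"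
  using assms
  by (auto simp: Bops_def linear_simps dest: bounded_linear.linear linear_add linear_diff linear_scale linear_0)

lemma annihilator_linear:
  assumes "f \<in> annihilator sm V"
  shows "f (x + y) = f x + f y" "f (x - y) = f x - f y" "f 0 = 0" "f (sm c x) = c * f x"
  using assms
  by (auto simp: annihilator_def linear_simps dest: bounded_linear.linear linear_add linear_diff linear_0)

lemma annihilator_zero: "f \<in> annihilator sm V \<Longrightarrow> v \<in> V \<Longrightarrow> f v = 0"
  by (simp add: annihilator_def)

lemma annihilator_add:
  "f \<in> annihilator sm V \<Longrightarrow> g \<in> annihilator sm V \<Longrightarrow> (\<lambda>z. f z + g z) \<in> annihilator sm V"
  by (auto simp: annihilator_def algebra_simps intro: bounded_linear_add)

lemma annihilator_comp:
  assumes f: "f \<in> annihilator sm V" and A: "A \<in> Bops sm" "A ` V \<subseteq> V"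
  shows "(\<lambda>z. f (A z)) \<in> annihilator sm V"
  using assms bounded_linear_compose[of f A] by (auto simp: annihilator_def Bops_def)

lemma tensor_Bops: assumes f: "f \<in> annihilator sm V" shows "tensor sm x f \<in> Bops sm"
proof -
  have lf: "bounded_linear f" using f by (simp add: annihilator_def)
  have "bounded_linear (\<lambda>a. sm a x)"
    by (rule bounded_linear_intro[where K = "norm x"])
       (auto simp: sm_add norm_sm scaleR_conv_of_real sm_mult sm_of_real)
  then have "bounded_linear (tensor sm x f)"
    unfolding tensor_def using lf by (rule bounded_linear_compose)
  then show ?thesis
    by (simp add: Bops_def tensor_def annihilator_linear(4)[OF f] sm_mult)
qed

lemma kjoin_upper: "E \<in> F \<Longrightarrow> E \<subseteq> kjoin sm F"
  unfolding kjoin_def by auto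

lemma kjoin_least: "closed_ksubspace sm V \<Longrightarrow> (\<And>E. E \<in> F \<Longrightarrow> E \<subseteq> V) \<Longrightarrow> kjoin sm F \<subseteq> V"
  unfolding kjoin_def by auto

lemma closed_ksubspace_equalizer:
  assumes "S \<in> Bops sm" "T \<in> Bops sm"
  shows "closed_ksubspace sm {z. S z = T z}"
proof -
  have "closed {z. S z = T z}"
    using assms by (intro closed_Collect_eq linear_continuous_on) (simp_all add: Bops_def)
  then show ?thesis
    using assms by (auto simp: closed_ksubspace_def ksubspace_def Bops_linear)
qed

lemma Bops_comp: "A \<in> Bops sm \<Longrightarrow> B \<in> Bops sm \<Longrightarrow> (\<lambda>z. A (B z)) \<in> Bops sm"
  using bounded_linear_compose[of A B] by (auto simp: Bops_def)

end

section \<open>The algebra of a subspace lattice and its rank-one operators\<close>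

locale kspace_lattice = kspace sm
  for sm :: "'k::real_normed_field \<Rightarrow> 'a::real_normed_vector \<Rightarrow> 'a" +
  fixes \<L> :: "'a set set"
  assumes lattice: "subspace_lattice sm \<L>"
begin

abbreviation \<A> where "\<A> \<equiv> alg sm \<L>"
abbreviation pred where "pred \<equiv> lminus sm \<L>"

lemma \<L>_closed: "E \<in> \<L> \<Longrightarrow> closed_ksubspace sm E"
  using lattice by (simp add: subspace_lattice_def)

lemma pred_mem: "pred E \<in> \<L>"
  using lattice by (auto simp: subspace_lattice_def lminus_def)

lemma subset_pred: "F \<in> \<L> \<Longrightarrow> \<not> E \<subseteq> F \<Longrightarrow> F \<subseteq> pred E"
  unfolding lminus_def by (rule kjoin_upper) simp

lemma closed_pred: "closed_ksubspace sm (pred E)"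
  by (rule \<L>_closed[OF pred_mem])

lemma alg_Bops: "A \<in> \<A> \<Longrightarrow> A \<in> Bops sm"
  by (simp add: alg_def)

lemma alg_mem: "A \<in> \<A> \<Longrightarrow> E \<in> \<L> \<Longrightarrow> x \<in> E \<Longrightarrow> A x \<in> E"
  by (auto simp: alg_def)

lemma alg_id: "(\<lambda>z. z) \<in> \<A>"
  by (auto simp: alg_def Bops_def)

lemma alg_add: "A \<in> \<A> \<Longrightarrow> B \<in> \<A> \<Longrightarrow> (\<lambda>z. A z + B z) \<in> \<A>"
  using \<L>_closed by (auto simp: alg_def Bops_def closed_ksubspace_def ksubspace_def image_subset_iff sm_add
      intro: bounded_linear_add)

lemma alg_comp: "A \<in> \<A> \<Longrightarrow> B \<in> \<A> \<Longrightarrow> (\<lambda>z. A (B z)) \<in> \<A>"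
  using Bops_comp[of A B] by (auto simp: alg_def image_subset_iff)

text \<open>A lattice element \<open>E\<close> either contains \<open>K\<close>, hence
  \<open>x\<close>, or lies in \<open>pred K\<close>, where \<open>f\<close> vanishes.\<close>

lemma tensor_alg:
  assumes K: "K \<in> \<L>" "x \<in> K" and f: "f \<in> annihilator sm (pred K)"
  shows "tensor sm x f \<in> \<A>"
proof -
  have "tensor sm x f z \<in> E" if E: "E \<in> \<L>" "z \<in> E" for E z
  proof (cases "K \<subseteq> E")
    case True
    then show ?thesis
      using K(2) \<L>_closed[OF E(1)] by (auto simp: tensor_def closed_ksubspace_def ksubspace_def)
  next
    case False
    then have "f z = 0" using subset_pred[OF E(1)] E(2) annihilator_zero[OF f] by blast
    then show ?thesis
      using \<L>_closed[OF E(1)] by (simp add: tensor_def closed_ksubspace_def ksubspace_def)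
  qed
  then show ?thesis using tensor_Bops[OF f] by (auto simp: alg_def)
qed

end

subsection \<open>Operators with vanishing double commutators\<close>

text \<open>The assumption says that \<open>[A, [A, T]] = 0\<close>, so \<open>D\<close> is a commuting derivation.\<close>

locale double_commutator = kspace_lattice +
  fixes T :: "'b \<Rightarrow> 'b"
  assumes T: "T \<in> Bops sm"
    and double_commutator: "A \<in> \<A> \<Longrightarrow> T (A (A z)) + A (A (T z)) = A (T (A z)) + A (T (A z))"
begin

definition D :: "('b \<Rightarrow> 'b) \<Rightarrow> 'b \<Rightarrow> 'b" where
  "D A z = T (A z) - A (T z)"

lemma D_add: "D (\<lambda>z. A z + B z) z = D A z + D B z"
  by (simp add: D_def Bops_linear[OF T])

lemma D_comp: "A \<in> \<A> \<Longrightarrow> D (\<lambda>z. A (B z)) z = D A (B z) + A (D B z)"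
  by (simp add: D_def Bops_linear alg_Bops)

lemma D_Bops: assumes "A \<in> \<A>" shows "D A \<in> Bops sm"
proof -
  have "(\<lambda>z. T (A z)) \<in> Bops sm" "(\<lambda>z. A (T z)) \<in> Bops sm"
    by (rule Bops_comp[OF T alg_Bops[OF assms]], rule Bops_comp[OF alg_Bops[OF assms] T])
  then show ?thesis
    unfolding Bops_def D_def[abs_def] by (auto intro: bounded_linear_sub simp: sm_diff)
qed

lemmas T_linear = Bops_linear[OF T]

section \<open>Linearization and Posner-type identities\<close>

lemma double_commutator_polarized:
  assumes A: "A \<in> \<A>" and B: "B \<in> \<A>"
  shows "T (A (B z)) + T (B (A z)) + A (B (T z)) + B (A (T z)) =
    A (T (B z)) + A (T (B z)) + B (T (A z)) + B (T (A z))"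
    (is "?l = ?r")
proof -
  define e where "e C = (T (C (C z)) + C (C (T z))) - (C (T (C z)) + C (T (C z)))" for C
  have "e (\<lambda>z. A z + B z) = 0" "e A = 0" "e B = 0"
    using double_commutator[OF alg_add[OF A B], of z] double_commutator[OF A, of z]
      double_commutator[OF B, of z] by (simp_all add: e_def)
  moreover have "?l - ?r = e (\<lambda>z. A z + B z) - e A - e B"
    by (simp add: e_def T_linear Bops_linear[OF alg_Bops[OF A]] Bops_linear[OF alg_Bops[OF B]]
        algebra_simps)
  ultimately show ?thesis by simp
qed

text \<open>Compare the polarized identity for \<open>A\<close>, \<open>B\<close>, multiplied by
  \<open>A\<close> on the right, with the one for \<open>A\<close> and \<open>B A\<close>: the
  difference is \<open>[A, B] D(A)\<close> up to a multiple of
  \<open>B [A, [A, T]] = 0\<close>.\<close>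

lemma commutator_D:
  assumes A: "A \<in> \<A>" and B: "B \<in> \<A>"
  shows "A (B (D A z)) = B (A (D A z))"
proof -
  note lin = T_linear Bops_linear[OF alg_Bops[OF A]] Bops_linear[OF alg_Bops[OF B]]
  define e1 where "e1 = (T (A (B (A z))) + T (B (A (A z))) + A (B (T (A z))) + B (A (T (A z))))
     - (A (T (B (A z))) + A (T (B (A z))) + B (T (A (A z))) + B (T (A (A z))))"
  define e2 where "e2 = (T (A (B (A z))) + T (B (A (A z))) + A (B (A (T z))) + B (A (A (T z))))
     - (A (T (B (A z))) + A (T (B (A z))) + B (A (T (A z))) + B (A (T (A z))))"
  define e3 where "e3 = B (T (A (A z)) + A (A (T z))) - B (A (T (A z)) + A (T (A z)))"
  have "e1 = 0" "e2 = 0" "e3 = 0"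
    using double_commutator_polarized[OF A B, of "A z"]
      double_commutator_polarized[OF A alg_comp[OF B A], of z] double_commutator[OF A, of z]
    by (simp_all add: e1_def e2_def e3_def)
  moreover have "A (B (D A z)) - B (A (D A z)) = e1 - e2 + e3 + e3"
    by (simp add: e1_def e2_def e3_def D_def lin algebra_simps)
  ultimately show ?thesis by simp
qed

text \<open>The mirror image: multiply by \<open>A\<close> on the left and compare with the
  polarized identity for \<open>A\<close> and \<open>A B\<close>.\<close>

lemma D_commutator:
  assumes A: "A \<in> \<A>" and B: "B \<in> \<A>"
  shows "D A (A (B z)) = D A (B (A z))"
proof -
  note lin = T_linear Bops_linear[OF alg_Bops[OF A]] Bops_linear[OF alg_Bops[OF B]]
  define e1 where "e1 = (T (A (A (B z))) + T (A (B (A z))) + A (A (B (T z))) + A (B (A (T z))))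
     - (A (T (A (B z))) + A (T (A (B z))) + A (B (T (A z))) + A (B (T (A z))))"
  define e2 where "e2 = A (T (A (B z)) + T (B (A z)) + A (B (T z)) + B (A (T z)))
     - A (A (T (B z)) + A (T (B z)) + B (T (A z)) + B (T (A z)))"
  define e3 where "e3 = (T (A (A (B z))) + A (A (T (B z)))) - (A (T (A (B z))) + A (T (A (B z))))"
  have "e1 = 0" "e2 = 0" "e3 = 0"
    using double_commutator_polarized[OF A B, of z]
      double_commutator_polarized[OF A alg_comp[OF A B], of z] double_commutator[OF A, of "B z"]
    by (simp_all add: e1_def e2_def e3_def)
  moreover have "D A (A (B z)) - D A (B (A z)) = e2 - e1 + e3 + e3"
    by (simp add: e1_def e2_def e3_def D_def lin algebra_simps)
  ultimately show ?thesis by simp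
qed

text \<open>Expand \<open>[A, B C] = [A, B] C + B [A, C]\<close>; the whole commutator and
  \<open>[A, C]\<close> both annihilate \<open>D(A)\<close> from the left.\<close>

lemma commutator_mult_D:
  assumes A: "A \<in> \<A>" and B: "B \<in> \<A>" and C: "C \<in> \<A>"
  shows "A (B (C (D A z))) = B (A (C (D A z)))"
  using commutator_D[OF A alg_comp[OF B C], of z] commutator_D[OF A C, of z] by simp

text \<open>Expand \<open>[A, C B] = C [A, B] + [A, C] B\<close> behind \<open>D(A)\<close>.\<close>

lemma D_mult_commutator:
  assumes A: "A \<in> \<A>" and B: "B \<in> \<A>" and C: "C \<in> \<A>"
  shows "D A (C (A (B z))) = D A (C (B (A z)))"
  using D_commutator[OF A alg_comp[OF C B], of z] D_commutator[OF A C, of "B z"] by simp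

text \<open>For \<open>C\<close> the tensor of \<open>x\<close> and \<open>f\<close>, the product
  \<open>D(A) C [A, B]\<close> is the tensor of \<open>D A x\<close> and \<open>f\<close> composed
  with \<open>[A, B]\<close>; it is zero only if one factor is.\<close>

lemma D_vanishes_or_commutator:
  assumes K: "K \<in> \<L>" "x \<in> K" "f \<in> annihilator sm (pred K)" and A: "A \<in> \<A>" and B: "B \<in> \<A>"
    and nz: "D A x \<noteq> 0"
  shows "f (A (B z)) = f (B (A z))"
proof -
  have "sm (f (A (B z))) (D A x) = sm (f (B (A z))) (D A x)"
    using D_mult_commutator[OF A B tensor_alg[OF K], of z]
    by (simp add: tensor_def Bops_linear(5)[OF D_Bops[OF A]])
  then show ?thesis using nz by (simp add: sm_left_cancel)
qed

text \<open>The dual statement: \<open>[A, B] C D(A)\<close> is the tensor of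
  \<open>[A, B] x\<close> and \<open>f\<close> composed with \<open>D A\<close>.\<close>

lemma D_functional_vanishes_or_commutator:
  assumes K: "K \<in> \<L>" "x \<in> K" "f \<in> annihilator sm (pred K)" and A: "A \<in> \<A>" and B: "B \<in> \<A>"
    and nz: "f (D A z) \<noteq> 0"
  shows "A (B x) = B (A x)"
proof -
  have "sm (f (D A z)) (A (B x) - B (A x)) = 0"
    using commutator_mult_D[OF A B tensor_alg[OF K], of z]
    by (simp add: tensor_def Bops_linear(5) alg_Bops A B sm_diff)
  then show ?thesis using nz by simp
qed

section \<open>Scalar action on lattice elements not contained in their predecessor\<close>

text \<open>For \<open>C\<close> the tensor of \<open>y\<close> and \<open>f\<close>,
  \<open>C C = f(y) C\<close> and \<open>C T C = f(T y) C\<close>. Evaluating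
  \<open>[C, [C, T]] = 0\<close> at \<open>y\<close> gives the eigenvector, and applying
  \<open>f\<close> to it gives the eigenfunctional.\<close>

lemma eigenvector:
  assumes K: "K \<in> \<L>" "y \<in> K" and f: "f \<in> annihilator sm (pred K)" and nz: "f y \<noteq> 0"
  obtains c where "T y = sm c y" "\<And>z. f (T z) = c * f z"
proof
  define c where "c = f (T y) / f y"
  note lin = annihilator_linear[OF f] Bops_linear[OF T]
  have eq: "sm (f y * f z) (T y) + sm (f y * f (T z)) y = sm (f z * f (T y)) y + sm (f z * f (T y)) y" for z
    using double_commutator[OF tensor_alg[OF K f], of z]
    by (simp add: tensor_def lin sm_mult[symmetric] mult.commute)
  from eq[of y] have "sm (f y * f y) (T y) = sm (f y * f (T y)) y" by simp
  then have "sm (inverse (f y * f y)) (sm (f y * f y) (T y)) =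
      sm (inverse (f y * f y)) (sm (f y * f (T y)) y)" by simp
  then show Ty: "T y = sm c y"
    using nz by (simp add: sm_mult[symmetric] c_def field_simps)
  fix z
  have "f (sm (f y * f z) (T y) + sm (f y * f (T z)) y) = f (sm (f z * f (T y)) y + sm (f z * f (T y)) y)"
    using eq[of z] by simp
  then have "f y * f y * f (T z) = f y * f y * (c * f z)"
    by (simp add: Ty lin algebra_simps)
  then show "f (T z) = c * f z" using nz by simp
qed

text \<open>A fixed pair with \<open>g x = 1\<close> determines \<open>c\<close>. A vector
  \<open>y\<close> with \<open>g y \<noteq> 0\<close> shares this eigenvalue through
  \<open>g\<close>; if \<open>g y = 0\<close>, use \<open>x + y\<close> instead. Functionals are
  treated dually, with \<open>f + g\<close> when \<open>f x = 0\<close>.\<close>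

lemma scalar_on_non_nilpotent:
  assumes K: "K \<in> \<L>" "\<not> K \<subseteq> pred K"
  obtains c where "\<And>y. y \<in> K \<Longrightarrow> T y = sm c y"
    "\<And>f z. f \<in> annihilator sm (pred K) \<Longrightarrow> f (T z) = c * f z"
proof -
  obtain x where x: "x \<in> K" "x \<notin> pred K" using K(2) by blast
  obtain g where g: "g \<in> annihilator sm (pred K)" "g x = 1"
    using separation[OF closed_pred x(2)] by blast
  obtain c where c: "T x = sm c x" "\<And>z. g (T z) = c * g z"
    using eigenvector[OF K(1) x(1) g(1)] g(2) by auto
  have "x \<noteq> 0" using g annihilator_linear(3)[OF g(1)] by auto
  have vec: "T y = sm c y" if y: "y \<in> K" "g y \<noteq> 0" for y
  proof -
    obtain d where d: "T y = sm d y" "\<And>z. g (T z) = d * g z"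
      using eigenvector[OF K(1) y(1) g(1) y(2)] by blast
    have "d = c" using d(2)[of x] c(2)[of x] g(2) by simp
    with d(1) show ?thesis by simp
  qed
  have fun': "f (T z) = c * f z" if f: "f \<in> annihilator sm (pred K)" "f x \<noteq> 0" for f z
  proof -
    obtain d where d: "T x = sm d x" "\<And>z. f (T z) = d * f z"
      using eigenvector[OF K(1) x(1) f] by blast
    have "d = c" using d(1) c(1) \<open>x \<noteq> 0\<close> by (simp add: sm_left_cancel)
    with d(2) show ?thesis by simp
  qed
  show thesis
  proof (rule that)
    fix y assume y: "y \<in> K"
    show "T y = sm c y"
    proof (cases "g y = 0")
      case True
      have "x + y \<in> K"
        using x(1) y \<L>_closed[OF K(1)] by (simp add: closed_ksubspace_def ksubspace_def)
      moreover have "g (x + y) = 1" using True g by (simp add: annihilator_linear)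
      ultimately have "T (x + y) = sm c (x + y)" using vec by simp
      then show ?thesis using c(1) by (simp add: T_linear sm_add)
    next
      case False with y show ?thesis by (rule vec)
    qed
  next
    fix f z assume f: "f \<in> annihilator sm (pred K)"
    show "f (T z) = c * f z"
    proof (cases "f x = 0")
      case True
      then have "f (T z) + g (T z) = c * (f z + g z)"
        using fun'[OF annihilator_add[OF f g(1)]] g(2) by simp
      then show ?thesis using c(2) by (simp add: algebra_simps)
    next
      case False with f show ?thesis by (rule fun')
    qed
  qed
qed

text \<open>\<open>A\<close> maps \<open>K\<close> into itself, and composing with \<open>A\<close>
  preserves the annihilator of \<open>pred K\<close>, so the same scalar \<open>c\<close> applies
  before and after \<open>A\<close>.\<close>

lemma D_vanishes_non_nilpotent:
  assumes K: "K \<in> \<L>" "\<not> K \<subseteq> pred K" and A: "A \<in> \<A>"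
  shows "x \<in> K \<Longrightarrow> D A x = 0" and "f \<in> annihilator sm (pred K) \<Longrightarrow> f (D A z) = 0"
proof -
  obtain c where c: "\<And>y. y \<in> K \<Longrightarrow> T y = sm c y"
    "\<And>f z. f \<in> annihilator sm (pred K) \<Longrightarrow> f (T z) = c * f z"
    using scalar_on_non_nilpotent[OF K] by metis
  show "D A x = 0" if "x \<in> K"
    using c(1)[OF that] c(1)[OF alg_mem[OF A K(1) that]]
    by (simp add: D_def Bops_linear(5)[OF alg_Bops[OF A]])
  show "f (D A z) = 0" if f: "f \<in> annihilator sm (pred K)"
  proof -
    have "(\<lambda>z. f (A z)) \<in> annihilator sm (pred K)"
      using A by (intro annihilator_comp[OF f alg_Bops[OF A]]) (auto intro: alg_mem pred_mem)
    from c(2)[OF this] c(2)[OF f] show ?thesis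
      by (simp add: D_def annihilator_linear[OF f])
  qed
qed

text \<open>In the nilpotent case \<open>K' \<subseteq> pred K'\<close>, a third element \<open>K''\<close> supplies rank-one operators
  \<open>S\<close> and \<open>R\<close> with \<open>f \<circ> [S, R] \<noteq> 0\<close>; as \<open>D A x\<close> and \<open>f \<circ> [A, R]\<close> cannot both be nonzero for
  any \<open>A\<close>, comparing \<open>A\<close>, \<open>S\<close> and \<open>A + S\<close> forces \<open>D A x = 0\<close>.\<close>

lemma D_vanishes_on_Jset:
  assumes join: "kjoin sm (Jset sm \<L>) = UNIV" and A: "A \<in> \<A>"
    and K: "K \<in> Jset sm \<L>" and x: "x \<in> K"
  shows "D A x = 0"
proof -
  have KL: "E \<in> \<L>" if "E \<in> Jset sm \<L>" for E using that by (simp add: Jset_def)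
  \<comment> \<open>The proper closed subspace \<open>pred E\<close> cannot contain every member of
    \<open>Jset\<close>, since their join is the whole space.\<close>
  have escape: "\<exists>K'\<in>Jset sm \<L>. \<exists>y\<in>K'. \<exists>f\<in>annihilator sm (pred E). f y = 1"
    if E: "E \<in> Jset sm \<L>" for E
  proof -
    have "\<not> kjoin sm (Jset sm \<L>) \<subseteq> pred E" using E join by (auto simp: Jset_def)
    then obtain K' y where "K' \<in> Jset sm \<L>" "y \<in> K'" "y \<notin> pred E"
      using kjoin_least[OF closed_pred[of E], of "Jset sm \<L>"] by auto
    with separation[OF closed_pred \<open>y \<notin> pred E\<close>] show ?thesis by blast
  qed
  obtain K' y f where K': "K' \<in> Jset sm \<L>" and y: "y \<in> K'"
    and f: "f \<in> annihilator sm (pred K)" "f y = 1"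
    using escape[OF K] by blast
  show ?thesis
  proof (cases "K' \<subseteq> pred K'")
    case False
    note D0 = D_vanishes_non_nilpotent(1)[OF KL[OF K'] False _ y]
    note R = tensor_alg[OF KL[OF K] x f(1)]
    \<comment> \<open>The rank-one operator carries \<open>y\<close> to \<open>x\<close> because
      \<open>f y = 1\<close>, so the product rule isolates \<open>D A x\<close>; the other two terms
      vanish since \<open>y\<close> lies in \<open>K'\<close>.\<close>
    have "D (\<lambda>z. A (tensor sm x f z)) y = D A (tensor sm x f y) + A (D (tensor sm x f) y)"
      by (rule D_comp[OF A])
    then show ?thesis
      using D0[OF alg_comp[OF A R]] D0[OF R] f(2)
      by (simp add: tensor_def Bops_linear(4)[OF alg_Bops[OF A]])
  next
    case True
    obtain K'' w g where K'': "K'' \<in> Jset sm \<L>" and w: "w \<in> K''"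
      and g: "g \<in> annihilator sm (pred K')" "g w = 1"
      using escape[OF K'] by blast
    obtain z h where h: "h \<in> annihilator sm (pred K'')" "h z = 1"
      using escape[OF K''] by blast
    have "\<not> K'' \<subseteq> pred K'" using w g annihilator_zero[OF g(1)] by force
    then have "pred K' \<subseteq> pred K''" by (rule subset_pred[OF pred_mem])
    with True have "K' \<subseteq> pred K''" by blast
    then have hy: "h y = 0" using y annihilator_zero[OF h(1)] by blast
    define S where "S = tensor sm y g"
    define R where "R = tensor sm w h"
    have S: "S \<in> \<A>" unfolding S_def by (rule tensor_alg[OF KL[OF K'] y g(1)])
    have R: "R \<in> \<A>" unfolding R_def by (rule tensor_alg[OF KL[OF K''] w h(1)])
    have SR: "f (S (R z)) = 1" "f (R (S z)) = 0"
      using f g h hy by (simp_all add: S_def R_def tensor_def annihilator_linear)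
    note dich = D_vanishes_or_commutator[OF KL[OF K] x f(1) _ R]
    have DS: "D S x = 0" using dich[OF S, of z] SR by auto
    show ?thesis
    proof (rule ccontr)
      assume nz: "D A x \<noteq> 0"
      then have "D (\<lambda>z. A z + S z) x \<noteq> 0" using DS by (simp add: D_add)
      from dich[OF alg_add[OF A S] this, of z] dich[OF A nz, of z] SR show False
        by (simp add: annihilator_linear[OF f(1)] Bops_linear[OF alg_Bops[OF R]])
    qed
  qed
qed

text \<open>Dual to the join case: a value outside \<open>pred K\<close> is detected by some
  \<open>f\<close>, and \<open>f\<close> composed with \<open>D A\<close> takes the place of
  \<open>D A x\<close>. The meet condition supplies the auxiliary rank-one operators
  \<open>S\<close> and \<open>R\<close> with \<open>[S, R] x \<noteq> 0\<close>.\<close>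

lemma D_range_in_pred:
  assumes meet: "\<Inter>(pred ` Jset sm \<L>) = {0}" and A: "A \<in> \<A>" and K: "K \<in> Jset sm \<L>"
  shows "D A z \<in> pred K"
proof (rule ccontr)
  assume "D A z \<notin> pred K"
  then obtain f where f: "f \<in> annihilator sm (pred K)" "f (D A z) = 1"
    using separation[OF closed_pred] by blast
  have KL: "E \<in> \<L>" if "E \<in> Jset sm \<L>" for E using that by (simp add: Jset_def)
  \<comment> \<open>A nonzero vector of \<open>E\<close> lies outside the zero intersection, hence
    outside some \<open>pred K'\<close>.\<close>
  have escape: "\<exists>K'\<in>Jset sm \<L>. \<exists>x\<in>E. \<exists>g\<in>annihilator sm (pred K'). g x = 1"
    if E: "E \<in> Jset sm \<L>" for E
  proof -
    have "0 \<in> E" using \<L>_closed[OF KL[OF E]] by (simp add: closed_ksubspace_def ksubspace_def)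
    then obtain x where "x \<in> E" "x \<noteq> 0" using E by (auto simp: Jset_def)
    moreover have "x \<notin> \<Inter>(pred ` Jset sm \<L>)" using meet \<open>x \<noteq> 0\<close> by simp
    then obtain K' where "K' \<in> Jset sm \<L>" "x \<notin> pred K'" by auto
    ultimately show ?thesis using separation[OF closed_pred \<open>x \<notin> pred K'\<close>] by blast
  qed
  obtain K' x g where K': "K' \<in> Jset sm \<L>" and x: "x \<in> K"
    and g: "g \<in> annihilator sm (pred K')" "g x = 1"
    using escape[OF K] by blast
  note lin = annihilator_linear[OF g(1)]
  show False
  proof (cases "K' \<subseteq> pred K'")
    case False
    note D0 = D_vanishes_non_nilpotent(2)[OF KL[OF K'] False _ g(1)]
    note R = tensor_alg[OF KL[OF K] x f(1)]
    \<comment> \<open>Applying \<open>g\<close> to the last term gives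
      \<open>f (D A z) * g x = 1\<close>, whereas \<open>g\<close> kills the other two
      terms.\<close>
    have "D (\<lambda>z. tensor sm x f (A z)) z = D (tensor sm x f) (A z) + tensor sm x f (D A z)"
      by (rule D_comp[OF R])
    then have "g (tensor sm x f (D A z)) = 0"
      using D0[OF alg_comp[OF R A], of z] D0[OF R, of "A z"] by (simp add: lin)
    then show False using f g by (simp add: tensor_def)
  next
    case True
    obtain K'' y h where K'': "K'' \<in> Jset sm \<L>" and y: "y \<in> K'"
      and h: "h \<in> annihilator sm (pred K'')" "h y = 1"
      using escape[OF K'] by blast
    obtain w E k where w: "w \<in> K''" and k: "k \<in> annihilator sm (pred E)" "k w = 1"
      using escape[OF K''] by blast
    from k have w0: "w \<noteq> 0" using annihilator_linear(3)[OF k(1)] by auto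
    \<comment> \<open>If \<open>K''\<close> were not inside \<open>pred K'\<close>, then
      \<open>K' \<subseteq> pred K' \<subseteq> pred K''\<close>, contradicting
      \<open>h y = 1\<close>. Hence \<open>g w = 0\<close>, which makes \<open>S (R x)\<close>
      vanish.\<close>
    have "\<not> K' \<subseteq> pred K''" using y h annihilator_zero[OF h(1)] by force
    moreover have "pred K' \<subseteq> pred K''" if "\<not> K'' \<subseteq> pred K'"
      using that by (rule subset_pred[OF pred_mem])
    ultimately have "K'' \<subseteq> pred K'" using True by blast
    then have gw: "g w = 0" using w annihilator_zero[OF g(1)] by blast
    define S where "S = tensor sm y g"
    define R where "R = tensor sm w h"
    have S: "S \<in> \<A>" unfolding S_def by (rule tensor_alg[OF KL[OF K'] y g(1)])
    have R: "R \<in> \<A>" unfolding R_def by (rule tensor_alg[OF KL[OF K''] w h(1)])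
    have SR: "R (S x) = w" "S (R x) = 0"
      using g h gw by (simp_all add: S_def R_def tensor_def annihilator_linear)
    note dich = D_functional_vanishes_or_commutator[OF KL[OF K] x f(1) _ R]
    have DS: "f (D S z) = 0" using dich[OF S, of z] SR w0 by auto
    then have "f (D (\<lambda>z. A z + S z) z) \<noteq> 0"
      using f by (simp add: D_add annihilator_linear[OF f(1)])
    from dich[OF alg_add[OF A S] this] dich[OF A, of z] SR f(2) w0 show False
      by (simp add: Bops_linear[OF alg_Bops[OF R]])
  qed
qed

text \<open>Under the join condition, the closed subspace where \<open>T A\<close> and
  \<open>A T\<close> agree contains every member of \<open>Jset\<close>. Under the meet condition,
  the values of \<open>D A\<close> lie in the intersection of all \<open>pred K\<close>.\<close>

lemma commutes_with_alg:
  assumes cond: "kjoin sm (Jset sm \<L>) = UNIV \<or> \<Inter>(pred ` Jset sm \<L>) = {0}" and A: "A \<in> \<A>"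
  shows "T (A z) = A (T z)"
  using cond
proof
  assume join: "kjoin sm (Jset sm \<L>) = UNIV"
  have "kjoin sm (Jset sm \<L>) \<subseteq> {z. T (A z) = A (T z)}"
  proof (rule kjoin_least)
    show "closed_ksubspace sm {z. T (A z) = A (T z)}"
      by (rule closed_ksubspace_equalizer[OF Bops_comp[OF T alg_Bops[OF A]] Bops_comp[OF alg_Bops[OF A] T]])
    show "E \<subseteq> {z. T (A z) = A (T z)}" if "E \<in> Jset sm \<L>" for E
      using D_vanishes_on_Jset[OF join A that] by (auto simp: D_def)
  qed
  with join show ?thesis by auto
next
  assume meet: "\<Inter>(pred ` Jset sm \<L>) = {0}"
  have "D A z \<in> \<Inter>(pred ` Jset sm \<L>)" using D_range_in_pred[OF meet A] by blast
  then show ?thesis by (simp add: meet D_def)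
qed

end

subsection \<open>Jordan centralizers\<close>

lemma kspace_real: "kspace (scaleR :: real \<Rightarrow> 'a::real_normed_vector \<Rightarrow> 'a)"
proof
  show "kaction (scaleR :: real \<Rightarrow> 'a \<Rightarrow> 'a)"
    by (simp add: kaction_def scaleR_add_left scaleR_add_right)
next
  fix V :: "'a set" and x
  assume V: "closed_ksubspace scaleR V" and x: "x \<notin> V"
  from V have "subspace V" "closed V"
    by (auto simp: closed_ksubspace_def ksubspace_def subspace_def)
  then obtain u where u: "bounded_linear u" "\<And>v. v \<in> V \<Longrightarrow> u v = 0" "u x \<noteq> (0::real)"
    using Hahn_Banach_separation x by blast
  have "(\<lambda>z. u z / u x) \<in> annihilator scaleR V"
    using u by (auto simp: annihilator_def linear_simps intro: bounded_linear_divide[THEN bounded_linear_compose])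
  with u(3) show "\<exists>f\<in>annihilator scaleR V. f x = 1" by (intro bexI) auto
qed

text \<open>A complex functional is recovered from its real part \<open>u\<close> as \<open>z \<mapsto> u z - i u (i z)\<close>.\<close>

lemma kspace_complex:
  fixes cs :: "complex \<Rightarrow> 'a::real_normed_vector \<Rightarrow> 'a"
  assumes cs: "kaction cs"
  shows "kspace cs"
proof
  show "kaction cs" by fact
next
  fix V :: "'a set" and x
  assume V: "closed_ksubspace cs V" and x: "x \<notin> V"
  have add: "cs (a + b) x = cs a x + cs b x" "cs a (x + y) = cs a x + cs a y"
    and mult: "cs (a * b) x = cs a (cs b x)"
    and real: "cs (of_real r) x = r *\<^sub>R x"
    and norm: "norm (cs a x) = cmod a * norm x" for a b x y r
    using cs by (simp_all add: kaction_def)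
  from V have "subspace V" "closed V"
    by (auto simp: closed_ksubspace_def ksubspace_def subspace_def real[symmetric])
  then obtain u where u: "bounded_linear u" "\<And>v. v \<in> V \<Longrightarrow> u v = 0" "u x \<noteq> (0::real)"
    using Hahn_Banach_separation x by blast
  have cs_scaleR: "cs a (r *\<^sub>R z) = r *\<^sub>R cs a z" for a r z
    by (metis mult real mult.commute)
  have cs_bl: "bounded_linear (cs a)" for a
    by (rule bounded_linear_intro[where K = "cmod a"]) (simp_all add: add norm cs_scaleR mult.commute)
  define f where "f z = complex_of_real (u z) - \<i> * complex_of_real (u (cs \<i> z))" for z
  have f_bl: "bounded_linear f"
    unfolding f_def
    by (intro bounded_linear_sub bounded_linear_mult_right[THEN bounded_linear_compose]
        bounded_linear_of_real[THEN bounded_linear_compose] u(1) bounded_linear_compose[OF u(1) cs_bl])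
  \<comment> \<open>Complex scaling reduces to real scalings and the operator
    \<open>cs \<i>\<close>, whose square is minus the identity; complex homogeneity of
    \<open>f\<close> then follows from real linearity of \<open>u\<close>.\<close>
  have cs_eq: "cs c z = Re c *\<^sub>R z + Im c *\<^sub>R cs \<i> z" for c z
  proof -
    have "cs (complex_of_real (Re c) + complex_of_real (Im c) * \<i>) z = Re c *\<^sub>R z + Im c *\<^sub>R cs \<i> z"
      by (simp only: add mult real)
    then show ?thesis by (simp add: complex_eq[of c, symmetric] mult.commute)
  qed
  have ii: "cs \<i> (cs \<i> z) = - z" for z
    using mult[of \<i> \<i> z] real[of "-1" z] by simp
  have f_cs: "f (cs c z) = c * f z" for c z
    unfolding f_def cs_eq[of c z]
    by (rule complex_eqI)
       (simp_all add: add cs_scaleR ii linear_simps[OF u(1)])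
  have "f v = 0" if "v \<in> V" for v
    using that V u(2) by (simp add: f_def closed_ksubspace_def ksubspace_def)
  moreover have fx: "f x \<noteq> 0" using u(3) by (simp add: f_def complex_eq_iff)
  ultimately have "(\<lambda>z. f z / f x) \<in> annihilator cs V"
    using f_bl f_cs
    by (auto simp: annihilator_def intro: bounded_linear_divide[THEN bounded_linear_compose])
  with fx show "\<exists>g\<in>annihilator cs V. g x = 1" by (intro bexI) auto
qed

text \<open>Polarizing the identity at \<open>A + I\<close> gives
  \<open>(m + n + 2 l) \<delta>(A) = (m + l) \<delta>(I) A + (n + l) A \<delta>(I)\<close>; substituting this into
  the identity leaves \<open>(m + l) (n + l) [A, [A, \<delta>(I)]] = 0\<close>.\<close>

lemma thm214_claim_kspace:
  fixes sm :: "'k::real_normed_field \<Rightarrow> 'a::banach \<Rightarrow> 'a"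
  assumes sm: "kspace sm" and ml: "m + l \<ge> 1" and nl: "n + l \<ge> 1"
  shows "thm214_claim sm m n l"
  unfolding thm214_claim_def
proof (intro allI impI)
  fix \<L> and \<delta> :: "('a \<Rightarrow> 'a) \<Rightarrow> 'a \<Rightarrow> 'a"
  assume lat: "subspace_lattice sm \<L>"
    and cond: "kjoin sm (Jset sm \<L>) = UNIV \<or> \<Inter>(lminus sm \<L> ` Jset sm \<L>) = {0}"
    and \<delta>_Bops: "\<forall>A\<in>alg sm \<L>. \<delta> A \<in> Bops sm"
    and \<delta>_add: "\<forall>A\<in>alg sm \<L>. \<forall>B\<in>alg sm \<L>. \<delta> (\<lambda>x. A x + B x) = (\<lambda>x. \<delta> A x + \<delta> B x)"
    and jordan: "\<forall>A\<in>alg sm \<L>.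
         (\<lambda>x. real (m + n + l) *\<^sub>R \<delta> (A \<circ> A) x) =
         (\<lambda>x. real m *\<^sub>R \<delta> A (A x) + real n *\<^sub>R A (\<delta> A x) + real l *\<^sub>R A (\<delta> id (A x)))"
  interpret kspace_lattice sm \<L>
    using sm lat by (simp add: kspace_lattice_def kspace_lattice_axioms_def)
  define T where "T = \<delta> (\<lambda>x. x)"
  define a b where "a = real (m + l)" and "b = real (n + l)"
  have ab: "a > 0" "b > 0" using ml nl by (simp_all add: a_def b_def)
  have T: "T \<in> Bops sm" using \<delta>_Bops alg_id by (simp add: T_def)
  have double: "(r * 2) *\<^sub>R v = r *\<^sub>R v + r *\<^sub>R v" "(r * (s * 2)) *\<^sub>R v = (r * s) *\<^sub>R v + (r * s) *\<^sub>R v"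
    for r s and v :: 'a
    by (simp_all only: mult_2_right distrib_left scaleR_add_left)
  have jordan': "real (m + n + l) *\<^sub>R \<delta> (\<lambda>x. A (A x)) z =
      real m *\<^sub>R \<delta> A (A z) + real n *\<^sub>R A (\<delta> A z) + real l *\<^sub>R A (T (A z))" if "A \<in> \<A>" for A z
    using fun_cong[OF bspec[OF jordan that], of z] by (simp add: T_def id_def comp_def)
  have formula: "(a + b) *\<^sub>R \<delta> A z = a *\<^sub>R T (A z) + b *\<^sub>R A (T z)" if A: "A \<in> \<A>" for A z
  proof -
    note lin = Bops_linear[OF alg_Bops[OF A]] Bops_linear[OF T]
      Bops_linear[OF \<delta>_Bops[rule_format, OF A]]
    have AI: "(\<lambda>x. A x + x) \<in> \<A>" by (rule alg_add[OF A alg_id])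
    have \<delta>AI: "\<delta> (\<lambda>x. A x + x) = (\<lambda>x. \<delta> A x + T x)"
      using \<delta>_add A alg_id by (simp add: T_def)
    \<comment> \<open>This is the expansion of \<open>(A + I)\<close> squared as a sum of members of
      the algebra.\<close>
    have "\<delta> (\<lambda>x. (A (A x) + A x) + (A x + x)) z = \<delta> (\<lambda>x. A (A x)) z + \<delta> A z + (\<delta> A z + T z)"
      using \<delta>_add[rule_format, OF alg_add[OF alg_comp[OF A A] A] AI]
        \<delta>_add[rule_format, OF alg_comp[OF A A] A] \<delta>AI by simp
    then have sq: "\<delta> (\<lambda>x. A (A x + x) + (A x + x)) z = \<delta> (\<lambda>x. A (A x)) z + \<delta> A z + (\<delta> A z + T z)"
      by (simp add: lin)
    have "real (m + n + l) *\<^sub>R (\<delta> (\<lambda>x. A (A x)) z + \<delta> A z + (\<delta> A z + T z)) =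
      real m *\<^sub>R (\<delta> A (A z + z) + T (A z + z)) +
      real n *\<^sub>R (A (\<delta> A z + T z) + (\<delta> A z + T z)) +
      real l *\<^sub>R (A (T (A z + z)) + T (A z + z))"
      using jordan'[OF AI, of z] unfolding \<delta>AI sq .
    \<comment> \<open>Subtracting the identity at \<open>A\<close> from the one at
      \<open>A + I\<close> removes the quadratic terms. The terms in \<open>T z\<close> cancel, and
      the coefficient of \<open>\<delta> A z\<close> is
      \<open>2 (m + n + l) - m - n = a + b\<close>.\<close>
    then have "(real (m + n + l) *\<^sub>R (\<delta> (\<lambda>x. A (A x)) z + \<delta> A z + (\<delta> A z + T z))) -
        real (m + n + l) *\<^sub>R \<delta> (\<lambda>x. A (A x)) z =
      (real m *\<^sub>R (\<delta> A (A z + z) + T (A z + z)) +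
      real n *\<^sub>R (A (\<delta> A z + T z) + (\<delta> A z + T z)) +
      real l *\<^sub>R (A (T (A z + z)) + T (A z + z))) -
      (real m *\<^sub>R \<delta> A (A z) + real n *\<^sub>R A (\<delta> A z) + real l *\<^sub>R A (T (A z)))"
      using jordan'[OF A, of z] by simp
    then show ?thesis by (simp add: a_def b_def lin double algebra_simps)
  qed
  have dc: "T (A (A z)) + A (A (T z)) = A (T (A z)) + A (T (A z))" if A: "A \<in> \<A>" for A z
  proof -
    note lin = Bops_linear[OF alg_Bops[OF A]] Bops_linear[OF T]
    have "(a + b) *\<^sub>R (real (m + n + l) *\<^sub>R \<delta> (\<lambda>x. A (A x)) z) =
      (a + b) *\<^sub>R (real m *\<^sub>R \<delta> A (A z) + real n *\<^sub>R A (\<delta> A z) + real l *\<^sub>R A (T (A z)))"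
      using jordan'[OF A] by simp
    also have "\<dots> = real m *\<^sub>R ((a + b) *\<^sub>R \<delta> A (A z)) + real n *\<^sub>R A ((a + b) *\<^sub>R \<delta> A z) +
        real l *\<^sub>R ((a + b) *\<^sub>R A (T (A z)))"
      by (simp add: lin algebra_simps)
    finally have "real (m + n + l) *\<^sub>R (a *\<^sub>R T (A (A z)) + b *\<^sub>R A (A (T z))) =
      real m *\<^sub>R (a *\<^sub>R T (A (A z)) + b *\<^sub>R A (T (A z))) +
      real n *\<^sub>R A (a *\<^sub>R T (A z) + b *\<^sub>R A (T z)) + real l *\<^sub>R ((a + b) *\<^sub>R A (T (A z)))"
      using formula[OF A] formula[OF alg_comp[OF A A], of z]
      by (metis scaleR_left_commute)
    \<comment> \<open>The coefficients of \<open>T A A\<close> and \<open>A A T\<close> are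
      \<open>a (n + l)\<close> and \<open>b (m + l)\<close>, both equal to \<open>a b\<close>; that
      of \<open>A T A\<close> is \<open>- (m b + n a + l (a + b)) = - 2 a b\<close>.\<close>
    moreover have "(a * b) *\<^sub>R (T (A (A z)) + A (A (T z)) - (A (T (A z)) + A (T (A z)))) =
      real (m + n + l) *\<^sub>R (a *\<^sub>R T (A (A z)) + b *\<^sub>R A (A (T z))) -
      (real m *\<^sub>R (a *\<^sub>R T (A (A z)) + b *\<^sub>R A (T (A z))) +
      real n *\<^sub>R A (a *\<^sub>R T (A z) + b *\<^sub>R A (T z)) + real l *\<^sub>R ((a + b) *\<^sub>R A (T (A z))))"
      by (simp add: lin a_def b_def double algebra_simps)
    ultimately show ?thesis using ab by simp
  qed
  interpret double_commutator sm \<L> T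
    by unfold_locales (use T dc in auto)
  have comm: "T (A z) = A (T z)" if "A \<in> \<A>" for A z
    using commutes_with_alg[OF cond that] .
  have \<delta>_eq: "\<delta> A z = T (A z)" if "A \<in> \<A>" for A z
  proof -
    have "(a + b) *\<^sub>R \<delta> A z = (a + b) *\<^sub>R T (A z)"
      using formula[OF that, of z] comm[OF that, of z] by (simp add: scaleR_add_left)
    then show ?thesis using ab by simp
  qed
  show "\<forall>A\<in>alg sm \<L>. \<forall>B\<in>alg sm \<L>. \<delta> (A \<circ> B) = \<delta> A \<circ> B \<and> \<delta> (A \<circ> B) = A \<circ> \<delta> B"
    by (auto simp: fun_eq_iff comp_def \<delta>_eq alg_comp comm)
qed

theorem theorem2p14:
  fixes m n l :: nat
  assumes "m + l \<ge> 1" and "n + l \<ge> 1"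
  shows "thm214_claim (scaleR :: real \<Rightarrow> 'a::banach \<Rightarrow> 'a) m n l \<and>
         (\<forall>cs :: complex \<Rightarrow> 'b::banach \<Rightarrow> 'b. kaction cs \<longrightarrow> thm214_claim cs m n l)"
  using thm214_claim_kspace[OF kspace_real assms] thm214_claim_kspace[OF kspace_complex assms]
  by blast

end
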